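(* Assume $Z$ is a true $\mathbb Q$-martingale on $[0,T]$, let $q_t=E_{\mathbb Q}[Z_tX_t|\mathcal Y_t]$ and let $v_t$ be the smoother vector (with $v_T=\mathbf 1$ and $E_{\mathbb Q}[Z_TX_t|\mathcal Y_T]=\mathrm{diag}(v_t)q_t$). Define the diagonal matrix-valued process $$\Gamma_t=\exp\Big(-\int_{]0,t]}(\Lambda_s-I)\,ds\Big)\prod_{s\in]0,t]}\Lambda_s^{\Delta Y_s}.$$ Then $\bar q_t:=\Gamma_t^{-1}q_t$ and $\bar v_t:=\Gamma_tv_t$ satisfy, for $0\le t\le T$, $$\bar q_t=\bar q_0+\int_{]0,t]}\Gamma_s^{-1}A_s\Gamma_s\,\bar q_s\,ds,$$ $$\bar v_t=\bar v_0-\int_{]0,t]}\Gamma_sA_s^\top\Gamma_s^{-1}\,\bar v_s\,ds=\Gamma_T\mathbf 1+\int_{]t,T]}\Gamma_sA_s^\top\Gamma_s^{-1}\,\bar v_s\,ds,$$ and $\langle q_t,v_t\rangle=\langle\bar q_t,\bar v_t\rangle$.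
   Context: Let $\mathcal X=\{e_1,\dots,e_N\}$ be the standard basis of $\mathbb R^N$ and $\mathbf 1=(1,\dots,1)^\top$. $X$ is a continuous-time Markov chain with values in $\mathcal X$ and deterministic rate matrix $A_t$ ($[A_t]_{ij}$, $i\ne j$, is the rate of jumping from $e_j$ to $e_i$). $Y$ is a counting process (right-continuous, integer-valued, nondecreasing, $Y_0=0$, jumps of size $1$), $\mathbb D$ its path space, $\mathcal Y_t=\sigma(Y_s;s\le t)$, $\mathcal F_t=\sigma(Y_s,X_s;s\le t)$. The intensity function $\lambda:\mathcal X\times[0,\infty[\times\mathbb D\to]0,\infty[$ is measurable with respect to (all subsets of $\mathcal X$) $\times$ (the predictable $\sigma$-algebra of $\{\mathcal Y_t\}$), with $s\mapsto\lambda(X_{s-},s,Y_{(\cdot)})$ left-continuous; $\lambda_u=\lambda(X_{u-},u,Y_{(\cdot)})$, and $\Lambda_u$ is the diagonal matrix with $(\Lambda_u)_{ii}=\lambda(e_i,u,Y_{(\cdot)})$. $\mathbb Q$ is a measure under which $Y$ is a rate-$1$ Poisson process independent of $X$ and $X$ is Markov with rate matrix $A_t$; $Z_t=\exp(-\int_{]0,t]}(\lambda_u-1)du)\prod_{u\in]0,t]}\lambda_u^{\Delta Y_u}$. The filter satisfies $q_t=q_0+\int_{]0,t]}(\Lambda_u-I)q_{u-}(dY_u-du)+\int_{]0,t]}A_uq_u\,du$ and the smoother vector satisfies $dv_t=-(A_t^\top-\Lambda_t+I)v_{t-}dt+(\Lambda_t^{-1}-I)v_{t-}dY_t$, $v_T=\mathbf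 1$. *)

theory Defs
  imports "HOL-Analysis.Analysis"
begin

text \<open>Pathwise setting. The state space {e_1,...,e_N} is indexed by a finite type 'n;
  vectors in R^N are real^'n and N x N matrices are real^'n^'n.\<close>

definition diagm :: "real^'n \<Rightarrow> real^'n^'n" where
  "diagm d = (\<chi> i j. if i = j then d $ i else 0)"

definition left_lim :: "(real \<Rightarrow> 'a::t2_space) \<Rightarrow> real \<Rightarrow> 'a" where
  "left_lim f t = Lim (at_left t) f"

definition dY :: "(real \<Rightarrow> nat) \<Rightarrow> real \<Rightarrow> real" where
  "dY y u = real (y u) - left_lim (\<lambda>s. real (y s)) u"

definition jump_times :: "(real \<Rightarrow> nat) \<Rightarrow> real \<Rightarrow> real \<Rightarrow> real set" where
  "jump_times y a b = {u \<in> {a<..b}. dY y u \<noteq> 0}"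

definition counting_path :: "(real \<Rightarrow> nat) \<Rightarrow> bool" where
  "counting_path y \<longleftrightarrow> y 0 = 0 \<and> mono_on {0..} y
     \<and> (\<forall>t\<ge>0. continuous (at_right t) (\<lambda>s. real (y s)))
     \<and> (\<forall>t>0. dY y t \<in> {0, 1})"

definition Lam :: "('n \<Rightarrow> real \<Rightarrow> real) \<Rightarrow> real \<Rightarrow> real^'n^'n" where
  "Lam lam u = diagm (\<chi> i. lam i u)"

text \<open>Gamma_t = exp(-int_{]0,t]} (Lambda_s - I) ds) prod_{s in ]0,t]} Lambda_s^{Delta Y_s}
  (all matrices diagonal, so the matrix exponential and the product are taken entrywise).\<close>
definition Gamma :: "('n \<Rightarrow> real \<Rightarrow> real) \<Rightarrow> (real \<Rightarrow> nat) \<Rightarrow> real \<Rightarrow> real^'n^'n" where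
  "Gamma lam y t = diagm (\<chi> i.
      exp (- set_lebesgue_integral lborel {0<..t} (\<lambda>s. lam i s - 1))
      * (\<Prod>u\<in>jump_times y 0 t. lam i u powr dY y u))"

end

theory Submission
  imports Defs
begin

text \<open>
  All matrices other than $A$ are diagonal, so both equations split into scalar ones: $x$ minus
  its jumps $(m_u - 1) x_{u-}$ is the integral of $h x + f$. By variation of constants, $x / E$ is
  then the integral of $f / E$, where $E_t = \exp(\int_0^t h) \prod_{u \le t} m_u$. For the filter,
  $h = 1 - \lambda_i$, $m = \lambda_i$ and $E$ is the $i$-th diagonal entry of $\Gamma$; for the
  smoother, $h = \lambda_i - 1$, $m = 1 / \lambda_i$ and $E$ is its inverse.

  Dividing $x$ by the product of the $m_u$ removes the jumps, because $x_u = m_u x_{u-}$; the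
  exponential is then handled by the product rule. The coefficients are only integrable, so this
  cannot be done with pointwise derivatives. Instead, the two sides of the chain rule for
  $\varphi \circ F$, where $F$ is an indefinite integral of $f$, differ by a function whose
  increments are locally $o(\int |f|)$, and a bisection argument shows that it is constant. The
  product rule follows by polarization.
\<close>

section \<open>Cadlag paths\<close>

lemma left_lim_eq:
  fixes x :: "real \<Rightarrow> 'a::t2_space"
  assumes "(x \<longlongrightarrow> l) (at_left t)"
  shows "left_lim x t = l"
  unfolding left_lim_def using assms by (intro tendsto_Lim) simp_all

definition cadlag_on :: "real \<Rightarrow> real \<Rightarrow> (real \<Rightarrow> 'a::topological_space) \<Rightarrow> bool" where
  "cadlag_on a b x \<longleftrightarrow> (\<forall>t\<in>{a..<b}. continuous (at_right t) x) \<and>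
    (\<forall>t\<in>{a<..b}. \<exists>l. (x \<longlongrightarrow> l) (at_left t))"

lemma cadlag_on_tendsto_left_lim:
  fixes x :: "real \<Rightarrow> 'a::t2_space"
  assumes "cadlag_on a b x" "t \<in> {a<..b}"
  shows "(x \<longlongrightarrow> left_lim x t) (at_left t)"
proof -
  obtain l where "(x \<longlongrightarrow> l) (at_left t)"
    using assms unfolding cadlag_on_def by blast
  with left_lim_eq show ?thesis by metis
qed

lemma countable_left_isolated:
  fixes D :: "real set"
  assumes "\<And>t. t \<in> D \<Longrightarrow> \<exists>s<t. D \<inter> {s<..<t} = {}"
  shows "countable D"
proof -
  obtain p where p: "\<And>t. t \<in> D \<Longrightarrow> p t < t" "\<And>t. t \<in> D \<Longrightarrow> D \<inter> {p t<..<t} = {}"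
    using assms by metis
  define gap where "gap t = {p t<..<t}" for t
  have "inj_on gap D"
  proof (rule inj_onI)
    fix s t assume "s \<in> D" "t \<in> D" "gap s = gap t"
    then have "Sup {p s<..<s} = Sup {p t<..<t}" by (simp add: gap_def)
    with p(1)[OF \<open>s \<in> D\<close>] p(1)[OF \<open>t \<in> D\<close>] show "s = t" by simp
  qed
  moreover have "disjnt (gap s) (gap t)" if "s \<in> D" "t \<in> D" "s < t" for s t
    using p(2)[OF \<open>t \<in> D\<close>] that by (force simp: gap_def disjnt_def)
  then have "pairwise disjnt (gap ` D)"
    by (intro pairwise_imageI) (metis disjnt_sym linorder_less_linear)
  then have "countable (gap ` D)"
    by (intro countable_disjoint_open_subsets) (auto simp: gap_def)
  ultimately show ?thesis by (metis countable_image_inj_on)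
qed

lemma countable_left_discontinuities:
  fixes x :: "real \<Rightarrow> 'a::metric_space"
  shows "countable {t. \<exists>l. (x \<longlongrightarrow> l) (at_left t) \<and> l \<noteq> x t}"
proof -
  define big where "big e = {t. \<exists>l. (x \<longlongrightarrow> l) (at_left t) \<and> e < dist l (x t)}" for e
  have "countable (big e)" if "e > 0" for e
  proof (rule countable_left_isolated)
    fix t assume "t \<in> big e"
    then obtain l where "(x \<longlongrightarrow> l) (at_left t)" by (auto simp: big_def)
    then have "\<forall>\<^sub>F s in at_left t. dist (x s) l < e / 2"
      by (rule tendstoD) (use that in simp)
    then obtain p where p: "p < t" "\<And>s. p < s \<Longrightarrow> s < t \<Longrightarrow> dist (x s) l < e / 2"
      using eventually_at_left[of "t - 1" t] by auto
    have "dist k (x s) \<le> e" if s: "p < s" "s < t" and k: "(x \<longlongrightarrow> k) (at_left s)" for s k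
    proof -
      have "\<forall>\<^sub>F r in at_left s. dist l (x r) \<le> e / 2"
        unfolding eventually_at_left[OF s(1)]
        using p(2) s by (intro exI[of _ p]) (auto simp: dist_commute less_imp_le)
      then have "dist l k \<le> e / 2"
        using k by (intro Lim_dist_ubound) auto
      with p(2)[OF s] dist_triangle[of k "x s" l] show ?thesis
        by (simp add: dist_commute)
    qed
    then have "big e \<inter> {p<..<t} = {}" by (fastforce simp: big_def)
    with p(1) show "\<exists>s<t. big e \<inter> {s<..<t} = {}" by blast
  qed
  then have "countable (\<Union>n. big (inverse (of_nat (Suc n))))"
    by (intro countable_UN) auto
  then show ?thesis
  proof (rule countable_subset[rotated], intro subsetI)
    fix t assume "t \<in> {t. \<exists>l. (x \<longlongrightarrow> l) (at_left t) \<and> l \<noteq> x t}"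
    then obtain l where l: "(x \<longlongrightarrow> l) (at_left t)" "dist l (x t) > 0" by auto
    then obtain n where "inverse (of_nat (Suc n)) < dist l (x t)"
      using reals_Archimedean by blast
    with l(1) have "t \<in> big (inverse (of_nat (Suc n)))" by (auto simp: big_def)
    then show "t \<in> (\<Union>n. big (inverse (of_nat (Suc n))))" by blast
  qed
qed

lemma countable_left_lim_neq:
  fixes x :: "real \<Rightarrow> 'a::metric_space"
  assumes "cadlag_on a b x"
  shows "countable {t \<in> {a<..b}. left_lim x t \<noteq> x t}"
  using countable_left_discontinuities[of x]
  by (rule countable_subset[rotated]) (use cadlag_on_tendsto_left_lim[OF assms] in blast)

lemma set_borel_measurable_cadlag:
  fixes x :: "real \<Rightarrow> 'a::real_normed_vector"
  assumes "cadlag_on a b x"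
  shows "set_borel_measurable lborel {a<..b} x"
proof -
  define D where "D = insert b {t \<in> {a<..b}. left_lim x t \<noteq> x t}"
  have "countable D" using countable_left_lim_neq[OF assms] by (simp add: D_def)
  have "isCont x t" if "t \<in> {a<..b} - D" for t
  proof -
    have "(x \<longlongrightarrow> x t) (at_left t)"
      using cadlag_on_tendsto_left_lim[OF assms, of t] that by (auto simp: D_def)
    moreover have "(x \<longlongrightarrow> x t) (at_right t)"
      using assms that by (auto simp: cadlag_on_def continuous_within D_def)
    ultimately show ?thesis by (auto simp: isCont_def filterlim_at_split)
  qed
  then have "set_borel_measurable borel ({a<..b} - D) x"
    by (intro set_measurable_continuous_on continuous_at_imp_continuous_on
        sets.Diff sets.countable[OF _ \<open>countable D\<close>]) auto
  then show ?thesis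
    unfolding set_borel_measurable_def measurable_lborel2
    by (rule measurable_discrete_difference[OF _ \<open>countable D\<close>]) (auto simp: indicator_def)
qed

lemma tendsto_imp_eventually_in_bounded:
  fixes x :: "'b \<Rightarrow> 'a::metric_space"
  assumes "(x \<longlongrightarrow> l) F"
  shows "\<exists>S. bounded S \<and> (\<forall>\<^sub>F s in F. x s \<in> S)"
  using tendstoD[OF assms zero_less_one] bounded_ball[of l 1]
  by (intro exI[of _ "ball l 1"]) (simp add: dist_commute)

lemma cadlag_on_locally_bounded:
  fixes x :: "real \<Rightarrow> 'a::metric_space"
  assumes x: "cadlag_on a b x" and t: "t \<in> {a..b}"
  shows "\<exists>S. bounded S \<and> (\<forall>\<^sub>F s in at t. s \<in> {a..b} \<longrightarrow> x s \<in> S)"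
proof -
  have "\<exists>S. bounded S \<and> (\<forall>\<^sub>F s in at_left t. s \<in> {a..b} \<longrightarrow> x s \<in> S)"
  proof (cases "a < t")
    case True
    with t have "(x \<longlongrightarrow> left_lim x t) (at_left t)"
      by (intro cadlag_on_tendsto_left_lim[OF x]) simp
    from tendsto_imp_eventually_in_bounded[OF this] obtain S where "bounded S" "\<forall>\<^sub>F s in at_left t. x s \<in> S" by blast
    then show ?thesis by (intro exI[of _ S]) (auto elim!: eventually_mono)
  next
    case False
    then show ?thesis by (intro exI[of _ "{}"]) (auto simp: eventually_at_filter)
  qed
  then obtain L where L: "bounded L" "\<forall>\<^sub>F s in at_left t. s \<in> {a..b} \<longrightarrow> x s \<in> L" by blast
  have "\<exists>S. bounded S \<and> (\<forall>\<^sub>F s in at_right t. s \<in> {a..b} \<longrightarrow> x s \<in> S)"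
  proof (cases "t < b")
    case True
    with t x have "(x \<longlongrightarrow> x t) (at_right t)"
      by (simp add: cadlag_on_def continuous_within)
    from tendsto_imp_eventually_in_bounded[OF this] obtain S where "bounded S" "\<forall>\<^sub>F s in at_right t. x s \<in> S" by blast
    then show ?thesis by (intro exI[of _ S]) (auto elim!: eventually_mono)
  next
    case False
    then show ?thesis by (intro exI[of _ "{}"]) (auto simp: eventually_at_filter)
  qed
  then obtain R where R: "bounded R" "\<forall>\<^sub>F s in at_right t. s \<in> {a..b} \<longrightarrow> x s \<in> R" by blast
  have "\<forall>\<^sub>F s in at t. s \<in> {a..b} \<longrightarrow> x s \<in> L \<union> R"
    using L(2) R(2) unfolding eventually_at_split by (auto elim!: eventually_mono)
  with L(1) R(1) show ?thesis by (metis bounded_Un)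
qed

lemma bounded_image_cadlag:
  fixes x :: "real \<Rightarrow> 'a::metric_space"
  assumes x: "cadlag_on a b x" and "a \<le> b"
  shows "bounded (x ` {a..b})"
proof -
  have "bounded (x ` ({a..b} \<inter> {a..b}))"
    using \<open>a \<le> b\<close>
  proof (induct rule: Bolzano[where P = "\<lambda>s t. bounded (x ` ({a..b} \<inter> {s..t}))"])
    case (trans r s t)
    then have "{a..b} \<inter> {r..t} = ({a..b} \<inter> {r..s}) \<union> ({a..b} \<inter> {s..t})" by auto
    with trans show ?case by (simp add: image_Un)
  next
    case (local t)
    then obtain S where S: "bounded S" "\<forall>\<^sub>F s in at t. s \<in> {a..b} \<longrightarrow> x s \<in> S"
      using cadlag_on_locally_bounded[OF x, of t] by auto
    then obtain d where "d > 0" "\<And>s. s \<noteq> t \<Longrightarrow> dist s t < d \<Longrightarrow> s \<in> {a..b} \<Longrightarrow> x s \<in> S"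
      unfolding eventually_at by auto
    then have "x ` ({a..b} \<inter> {r..s}) \<subseteq> insert (x t) S" if "r \<le> t" "t \<le> s" "s - r < d" for r s
      using that by (force simp: dist_real_def)
    then show ?case
      using \<open>d > 0\<close> S(1) by (metis bounded_insert bounded_subset)
  qed
  then show ?thesis by simp
qed

section \<open>Set integrals\<close>

lemma set_integrable_bounded_bilinear:
  fixes mul :: "'b::{banach, second_countable_topology} \<Rightarrow>
      'c::{real_normed_vector, second_countable_topology} \<Rightarrow> 'd::{banach, second_countable_topology}"
  assumes "bounded_bilinear mul" and f: "set_integrable M S f"
    and g: "set_borel_measurable M S g" "bounded (g ` S)"
  shows "set_integrable M S (\<lambda>t. mul (f t) (g t))"
proof -
  interpret bounded_bilinear mul by fact
  obtain K where K: "K \<ge> 0" "\<And>u v. norm (mul u v) \<le> norm u * norm v * K"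
    using nonneg_bounded by blast
  obtain B where B: "\<And>t. t \<in> S \<Longrightarrow> norm (g t) \<le> B"
    using g(2) by (auto simp: bounded_iff)
  have "continuous_on UNIV (\<lambda>p. mul (fst p) (snd p))"
    by (intro continuous_on[OF continuous_on_fst continuous_on_snd] continuous_on_id)
  then have "(\<lambda>t. mul (indicator S t *\<^sub>R f t) (indicator S t *\<^sub>R g t)) \<in> borel_measurable M"
    using borel_measurable_continuous_Pair[where H = mul]
      borel_measurable_integrable[OF f[unfolded set_integrable_def]] g(1)
    by (simp add: set_borel_measurable_def)
  moreover have "mul (indicator S t *\<^sub>R f t) (indicator S t *\<^sub>R g t) = indicator S t *\<^sub>R mul (f t) (g t)" for t
    by (simp add: indicator_def zero_left)
  ultimately have "set_borel_measurable M S (\<lambda>t. mul (f t) (g t))"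
    by (simp add: set_borel_measurable_def)
  moreover have "norm (mul (f t) (g t)) \<le> norm ((B * K) *\<^sub>R f t)" if "t \<in> S" for t
  proof -
    have "norm (mul (f t) (g t)) \<le> norm (f t) * norm (g t) * K" by (rule K(2))
    also have "\<dots> \<le> norm (f t) * \<bar>B\<bar> * K"
      using B[OF that] K(1) by (intro mult_right_mono mult_left_mono) auto
    finally show ?thesis using K(1) by (simp add: abs_mult ac_simps)
  qed
  ultimately show ?thesis
    by (intro set_integrable_bound[OF set_integrable_scaleR_right[OF f]]) auto
qed

lemma set_integrable_cadlag_bilinear:
  fixes mul :: "'b::{banach, second_countable_topology} \<Rightarrow>
      'c::{real_normed_vector, second_countable_topology} \<Rightarrow> 'd::{banach, second_countable_topology}"
  assumes "bounded_bilinear mul" "set_integrable lborel {a<..b} f" "cadlag_on a b x"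
  shows "set_integrable lborel {a<..b} (\<lambda>t. mul (f t) (x t))"
proof (cases "a \<le> b")
  case True
  have "bounded (x ` {a<..b})"
    by (rule bounded_subset[OF bounded_image_cadlag[OF assms(3) True]]) auto
  then show ?thesis
    using set_integrable_bounded_bilinear[OF assms(1,2) set_borel_measurable_cadlag[OF assms(3)]] by blast
qed simp

lemma bounded_linear_axis: "bounded_linear (axis i :: 'b::euclidean_space \<Rightarrow> 'b^'n)"
  unfolding linear_conv_bounded_linear[symmetric] by (intro linearI) (simp_all add: axis_def vec_eq_iff)

lemma set_integrable_vec_iff:
  fixes f :: "'a \<Rightarrow> 'b::euclidean_space^'n"
  shows "set_integrable M S f \<longleftrightarrow> (\<forall>i. set_integrable M S (\<lambda>t. f t $ i))"
proof (intro iffI allI)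
  fix i assume "set_integrable M S f"
  then have "integrable M (\<lambda>t. (indicator S t *\<^sub>R f t) $ i)"
    unfolding set_integrable_def by (rule integrable_bounded_linear[OF bounded_linear_vec_nth])
  then show "set_integrable M S (\<lambda>t. f t $ i)" by (simp add: set_integrable_def)
next
  assume "\<forall>i. set_integrable M S (\<lambda>t. f t $ i)"
  then have "integrable M (\<lambda>t. axis i (indicator S t *\<^sub>R f t $ i) :: 'b^'n)" for i
    by (intro integrable_bounded_linear[OF bounded_linear_axis]) (simp add: set_integrable_def)
  then have "integrable M (\<lambda>t. \<Sum>i\<in>UNIV. axis i (indicator S t *\<^sub>R f t $ i))"
    by (rule Bochner_Integration.integrable_sum)
  moreover have "(\<Sum>i\<in>UNIV. axis i (indicator S t *\<^sub>R f t $ i)) = indicator S t *\<^sub>R f t" for t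
    by (simp add: vec_eq_iff axis_def)
  ultimately show "set_integrable M S f" by (simp add: set_integrable_def)
qed

lemma set_lebesgue_integral_vec_nth:
  fixes f :: "'a \<Rightarrow> 'b::euclidean_space^'n"
  assumes "set_integrable M S f"
  shows "(LINT t:S|M. f t) $ i = (LINT t:S|M. f t $ i)"
  using integral_bounded_linear[OF bounded_linear_vec_nth[of i] assms[unfolded set_integrable_def]]
  by (simp add: set_lebesgue_integral_def)

lemma set_lebesgue_integral_minus: "(LINT t:S|M. - f t) = - (LINT t:S|M. f t)"
  by (simp add: set_lebesgue_integral_def)

lemma bounded_bilinear_matrix_vector_mult:
  "bounded_bilinear ((*v) :: real^'n^'m \<Rightarrow> real^'n \<Rightarrow> real^'m)"
  unfolding bilinear_conv_bounded_bilinear[symmetric] bilinear_def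
  by (auto intro!: linearI simp: matrix_vector_mult_add_rdistrib matrix_vector_right_distrib
      matrix_vector_mult_scaleR simp flip: scaleR_matrix_vector_assoc)

lemma
  fixes f g :: "real \<Rightarrow> 'a::{banach, second_countable_topology}"
  assumes "countable {u \<in> S. f u \<noteq> g u}"
  shows set_integrable_cong_countable: "set_integrable lborel S f \<longleftrightarrow> set_integrable lborel S g"
    and set_lebesgue_integral_cong_countable: "(LBINT u:S. f u) = (LBINT u:S. g u)"
  unfolding set_integrable_def set_lebesgue_integral_def
  by (rule integrable_discrete_difference[OF assms] integral_discrete_difference[OF assms];
      auto simp: indicator_def)+

lemma set_integrable_left_lim_bilinear:
  fixes mul :: "'b::{banach, second_countable_topology} \<Rightarrow>
      'c::{real_normed_vector, second_countable_topology} \<Rightarrow> 'd::{banach, second_countable_topology}"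
  assumes "bounded_bilinear mul" "set_integrable lborel {a<..b} f" and x: "cadlag_on a b x"
  shows "set_integrable lborel {a<..b} (\<lambda>t. mul (f t) (left_lim x t))"
proof -
  have "countable {t \<in> {a<..b}. mul (f t) (x t) \<noteq> mul (f t) (left_lim x t)}"
    by (rule countable_subset[OF _ countable_left_lim_neq[OF x]]) auto
  from set_integrable_cong_countable[OF this] show ?thesis
    using set_integrable_cadlag_bilinear[OF assms] by blast
qed

lemma set_integrable_Icc_imp_Ioc:
  fixes f :: "real \<Rightarrow> 'a::{banach, second_countable_topology}"
  assumes "set_integrable lborel {a..b} f"
  shows "set_integrable lborel {a<..b} f"
  using assms by (rule set_integrable_subset) auto

lemma set_integral_Ioc_split:
  fixes f :: "real \<Rightarrow> 'a::{banach, second_countable_topology}"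
  assumes "set_integrable lborel {a<..b} f" "a \<le> s" "s \<le> b"
  shows "(LBINT u:{a<..b}. f u) = (LBINT u:{a<..s}. f u) + (LBINT u:{s<..b}. f u)"
proof -
  have "set_integrable lborel {a<..s} f" "set_integrable lborel {s<..b} f"
    by (rule set_integrable_subset[OF assms(1)]; use assms in auto)+
  moreover have "{a<..s} \<inter> {s<..b} = {}" by auto
  ultimately have "(LBINT u:{a<..s} \<union> {s<..b}. f u) = (LBINT u:{a<..s}. f u) + (LBINT u:{s<..b}. f u)"
    by (intro set_integral_Un)
  then show ?thesis using ivl_disj_un_two(6)[OF assms(2,3)] by simp
qed

section \<open>Indefinite Lebesgue integrals\<close>

definition primitive_on ::
    "real \<Rightarrow> real \<Rightarrow> (real \<Rightarrow> 'a::{banach, second_countable_topology}) \<Rightarrow> (real \<Rightarrow> 'a) \<Rightarrow> bool" where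
  "primitive_on a b f F \<longleftrightarrow>
    set_integrable lborel {a<..b} f \<and> (\<forall>t\<in>{a..b}. F t - F a = (LBINT u:{a<..t}. f u))"

lemma primitive_onI:
  assumes "set_integrable lborel {a<..b} f"
    and "\<And>t. t \<in> {a..b} \<Longrightarrow> F t - F a = (LBINT u:{a<..t}. f u)"
  shows "primitive_on a b f F"
  using assms by (simp add: primitive_on_def)

lemma primitive_on_set_integrable:
  assumes "primitive_on a b f F" "a \<le> s" "t \<le> b"
  shows "set_integrable lborel {s<..t} f"
  by (rule set_integrable_subset[of lborel "{a<..b}"]) (use assms in \<open>auto simp: primitive_on_def\<close>)

lemma primitive_on_increment:
  assumes F: "primitive_on a b f F" and "a \<le> s" "s \<le> t" "t \<le> b"
  shows "F t - F s = (LBINT u:{s<..t}. f u)"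
proof -
  have "F t - F a = (LBINT u:{a<..t}. f u)" "F s - F a = (LBINT u:{a<..s}. f u)"
    using assms by (auto simp: primitive_on_def)
  moreover have "(LBINT u:{a<..t}. f u) = (LBINT u:{a<..s}. f u) + (LBINT u:{s<..t}. f u)"
    using assms by (intro set_integral_Ioc_split primitive_on_set_integrable[OF F]) auto
  ultimately show ?thesis by (simp add: algebra_simps)
qed

lemma primitive_on_subinterval:
  assumes F: "primitive_on a b f F" and "a \<le> s" "t \<le> b"
  shows "primitive_on s t f F"
  using assms primitive_on_increment[OF F] primitive_on_set_integrable[OF F]
  by (intro primitive_onI) auto

lemma primitive_on_cong_countable:
  assumes F: "primitive_on a b f F"
    and fg: "countable {u \<in> {a<..b}. f u \<noteq> g u}" and FG: "\<And>t. t \<in> {a..b} \<Longrightarrow> F t = G t"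
  shows "primitive_on a b g G"
proof (rule primitive_onI)
  show "set_integrable lborel {a<..b} g"
    using F set_integrable_cong_countable[OF fg] by (simp add: primitive_on_def)
  fix t assume t: "t \<in> {a..b}"
  then have "countable {u \<in> {a<..t}. f u \<noteq> g u}"
    by (intro countable_subset[OF _ fg]) auto
  then have "(LBINT u:{a<..t}. f u) = (LBINT u:{a<..t}. g u)"
    by (rule set_lebesgue_integral_cong_countable)
  then show "G t - G a = (LBINT u:{a<..t}. g u)"
    using primitive_on_increment[OF F, of a t] t FG[OF t] FG[of a] by simp
qed

lemma primitive_on_cong:
  assumes "primitive_on a b f F"
    and "\<And>u. u \<in> {a<..b} \<Longrightarrow> f u = g u" "\<And>t. t \<in> {a..b} \<Longrightarrow> F t = G t"
  shows "primitive_on a b g G"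
proof (rule primitive_on_cong_countable[OF assms(1) _ assms(3)])
  have "{u \<in> {a<..b}. f u \<noteq> g u} = {}" using assms(2) by auto
  then show "countable {u \<in> {a<..b}. f u \<noteq> g u}" by (simp only: countable_empty)
qed

lemma primitive_on_trans:
  assumes ab: "primitive_on a b f F" and bc: "primitive_on b c f F" and "a \<le> b" "b \<le> c"
  shows "primitive_on a c f F"
proof (rule primitive_onI)
  show int: "set_integrable lborel {a<..c} f"
    using set_integrable_Un[of lborel "{a<..b}" f "{b<..c}"] ivl_disj_un_two(6)[OF assms(3,4)] ab bc
    by (simp add: primitive_on_def)
  fix t assume t: "t \<in> {a..c}"
  show "F t - F a = (LBINT u:{a<..t}. f u)"
  proof (cases "t \<le> b")
    case True
    with ab t show ?thesis by (simp add: primitive_on_def)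
  next
    case False
    have "(LBINT u:{a<..t}. f u) = (LBINT u:{a<..b}. f u) + (LBINT u:{b<..t}. f u)"
      using t False assms(3) by (intro set_integral_Ioc_split set_integrable_subset[OF int]) auto
    also have "\<dots> = (F b - F a) + (F t - F b)"
      using ab bc t False assms(3) by (simp add: primitive_on_def)
    finally show ?thesis by simp
  qed
qed

lemma primitive_on_indefinite_integral:
  assumes "set_integrable lborel {a<..b} f"
  shows "primitive_on a b f (\<lambda>t. LBINT u:{a<..t}. f u)"
  using assms by (intro primitive_onI) (simp_all add: set_lebesgue_integral_def)

lemma primitive_on_backward_integral:
  assumes f: "set_integrable lborel {a<..b} f"
    and F: "\<And>t. t \<in> {a..b} \<Longrightarrow> F t = c + (LBINT u:{t<..b}. f u)"
  shows "primitive_on a b (\<lambda>u. - f u) F"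
proof (rule primitive_onI)
  show "set_integrable lborel {a<..b} (\<lambda>u. - f u)"
    using set_integrable_scaleR_right[of "-1", OF f] by simp
  fix t assume t: "t \<in> {a..b}"
  then have "(LBINT u:{a<..b}. f u) = (LBINT u:{a<..t}. f u) + (LBINT u:{t<..b}. f u)"
    by (intro set_integral_Ioc_split[OF f]) auto
  then show "F t - F a = (LBINT u:{a<..t}. - f u)"
    using F[of a] F[OF t] t by (simp add: set_lebesgue_integral_minus)
qed

lemma primitive_on_add:
  assumes F: "primitive_on a b f F" and G: "primitive_on a b g G"
  shows "primitive_on a b (\<lambda>u. f u + g u) (\<lambda>t. F t + G t)"
proof (rule primitive_onI)
  show "set_integrable lborel {a<..b} (\<lambda>u. f u + g u)"
    using F G by (simp add: primitive_on_def)
  fix t assume t: "t \<in> {a..b}"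
  then have "(LBINT u:{a<..t}. f u + g u) = (LBINT u:{a<..t}. f u) + (LBINT u:{a<..t}. g u)"
    by (intro set_integral_add primitive_on_set_integrable[OF F] primitive_on_set_integrable[OF G]) auto
  with primitive_on_increment[OF F, of a t] primitive_on_increment[OF G, of a t] t
  show "F t + G t - (F a + G a) = (LBINT u:{a<..t}. f u + g u)"
    by (simp add: algebra_simps)
qed

lemma primitive_on_scaleR:
  assumes "primitive_on a b f F"
  shows "primitive_on a b (\<lambda>u. c *\<^sub>R f u) (\<lambda>t. c *\<^sub>R F t)"
  using assms by (simp add: primitive_on_def flip: scaleR_diff_right)

lemma primitive_on_vec_iff:
  fixes f F :: "real \<Rightarrow> 'b::euclidean_space^'n"
  shows "primitive_on a b f F \<longleftrightarrow> (\<forall>i. primitive_on a b (\<lambda>u. f u $ i) (\<lambda>t. F t $ i))"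
proof (cases "set_integrable lborel {a<..b} f")
  case True
  then have "set_integrable lborel {a<..t} f" if "t \<in> {a..b}" for t
    using that by (intro set_integrable_subset[OF True]) auto
  then have "primitive_on a b f F \<longleftrightarrow> (\<forall>t\<in>{a..b}. \<forall>i. F t $ i - F a $ i = (LBINT u:{a<..t}. f u $ i))"
    using True by (simp add: primitive_on_def vec_eq_iff set_lebesgue_integral_vec_nth)
  then show ?thesis
    using True by (auto simp: primitive_on_def set_integrable_vec_iff[of lborel "{a<..b}" f])
next
  case False
  then show ?thesis by (auto simp: primitive_on_def set_integrable_vec_iff[of lborel "{a<..b}" f])
qed

lemma continuous_on_primitive:
  fixes f :: "real \<Rightarrow> 'a::euclidean_space"
  assumes F: "primitive_on a b f F"
  shows "continuous_on {a..b} F"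
proof -
  have "f integrable_on {a<..b}"
    using F by (intro set_borel_integral_eq_integral(1)) (simp add: primitive_on_def)
  then have "f integrable_on {a..b}"
    by (rule integrable_spike_set) (auto intro: negligible_subset[of "{a}"])
  then have "continuous_on {a..b} (\<lambda>t. F a + integral {a..t} f)"
    by (intro continuous_intros indefinite_integral_continuous_1)
  moreover have "F a + integral {a..t} f = F t" if t: "t \<in> {a..b}" for t
  proof -
    have "F t - F a = integral {a<..t} f"
      using set_borel_integral_eq_integral(2)[OF primitive_on_set_integrable[OF F, of a t]] F t
      by (simp add: primitive_on_def)
    also have "integral {a<..t} f = integral {a..t} f"
      by (rule integral_spike_set) (auto intro: negligible_subset[of "{a}"])
    finally show ?thesis by (simp add: algebra_simps)
  qed
  ultimately show ?thesis by (rule continuous_on_eq)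
qed

lemma set_integrable_mult_continuous:
  fixes f g :: "real \<Rightarrow> real"
  assumes f: "set_integrable lborel {a<..b} f" and g: "continuous_on {a..b} g"
  shows "set_integrable lborel {a<..b} (\<lambda>u. f u * g u)"
proof (rule set_integrable_bounded_bilinear[OF bounded_bilinear_mult f])
  have "continuous_on {a<..b} g" using g by (rule continuous_on_subset) auto
  then show "set_borel_measurable lborel {a<..b} g"
    using set_measurable_continuous_on[of "{a<..b}" g] by (simp add: set_borel_measurable_def)
  have "bounded (g ` {a..b})"
    by (intro compact_imp_bounded compact_continuous_image g compact_Icc)
  then show "bounded (g ` {a<..b})" by (rule bounded_subset) auto
qed

lemma primitive_on_compose_increment_le:
  fixes f F \<phi> \<phi>' :: "real \<Rightarrow> real"
  assumes F: "primitive_on s t f F" and "s \<le> t"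
    and int: "set_integrable lborel {s<..t} (\<lambda>u. f u * \<phi>' (F u))"
    and deriv: "\<And>z. (\<phi> has_real_derivative \<phi>' z) (at z)"
    and near: "\<And>u. u \<in> {s..t} \<Longrightarrow> F u \<in> ball y \<eta>" "\<And>z. z \<in> ball y \<eta> \<Longrightarrow> \<bar>\<phi>' z - c\<bar> \<le> e"
  shows "\<bar>\<phi> (F t) - \<phi> (F s) - (LBINT u:{s<..t}. f u * \<phi>' (F u))\<bar> \<le> 2 * e * (LBINT u:{s<..t}. \<bar>f u\<bar>)"
proof -
  have f: "set_integrable lborel {s<..t} f" using F by (simp add: primitive_on_def)
  note abs_f = set_integrable_abs[OF f]
  have incr: "F t - F s = (LBINT u:{s<..t}. f u)"
    using primitive_on_increment[OF F] \<open>s \<le> t\<close> by simp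
  have "e \<ge> 0" using near[of "F s"] near(1)[of s] \<open>s \<le> t\<close> by force
  have "norm ((\<phi> (F t) - c * F t) - (\<phi> (F s) - c * F s)) \<le> e * norm (F t - F s)"
  proof (rule field_differentiable_bound[OF convex_ball[of y \<eta>]])
    fix z assume "z \<in> ball y \<eta>"
    then show "norm (\<phi>' z - c) \<le> e" using near(2) by simp
    show "((\<lambda>z. \<phi> z - c * z) has_field_derivative \<phi>' z - c) (at z within ball y \<eta>)"
      by (auto intro!: derivative_eq_intros has_field_derivative_at_within[OF deriv])
  qed (use near(1) \<open>s \<le> t\<close> in simp_all)
  also have "\<dots> \<le> e * (LBINT u:{s<..t}. \<bar>f u\<bar>)"
    using set_integral_norm_bound[OF f] \<open>e \<ge> 0\<close> unfolding incr by (intro mult_left_mono) simp_all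
  finally have linearization:
    "\<bar>\<phi> (F t) - \<phi> (F s) - c * (F t - F s)\<bar> \<le> e * (LBINT u:{s<..t}. \<bar>f u\<bar>)"
    by (simp add: algebra_simps)
  have cf: "set_integrable lborel {s<..t} (\<lambda>u. c * f u)" using f by simp
  have "\<bar>c * (F t - F s) - (LBINT u:{s<..t}. f u * \<phi>' (F u))\<bar>
      = \<bar>LBINT u:{s<..t}. c * f u - f u * \<phi>' (F u)\<bar>"
    unfolding set_integral_diff(2)[OF cf int] by (simp add: incr)
  also have "\<dots> \<le> (LBINT u:{s<..t}. \<bar>c * f u - f u * \<phi>' (F u)\<bar>)"
    using set_integral_norm_bound[OF set_integral_diff(1)[OF cf int]] by simp
  also have "\<dots> \<le> (LBINT u:{s<..t}. e * \<bar>f u\<bar>)"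
  proof (rule set_integral_mono)
    fix u assume "u \<in> {s<..t}"
    then have "\<bar>\<phi>' (F u) - c\<bar> * \<bar>f u\<bar> \<le> e * \<bar>f u\<bar>"
      by (intro mult_right_mono near) auto
    then show "\<bar>c * f u - f u * \<phi>' (F u)\<bar> \<le> e * \<bar>f u\<bar>"
      by (simp add: abs_minus_commute algebra_simps flip: abs_mult)
  qed (use abs_f set_integrable_abs[OF set_integral_diff(1)[OF cf int]] in simp_all)
  finally show ?thesis using linearization by simp
qed

lemma increment_le_if_locally_increment_le:
  fixes W :: "real \<Rightarrow> 'a::real_normed_vector" and K :: "real \<Rightarrow> real"
  assumes "a \<le> b"
    and local_le: "\<And>x. x \<in> {a..b} \<Longrightarrow>
      \<exists>d>0. \<forall>s t. a \<le> s \<and> s \<le> x \<and> x \<le> t \<and> t \<le> b \<and> t - s < d \<longrightarrow> norm (W t - W s) \<le> K t - K s"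
  shows "norm (W b - W a) \<le> K b - K a"
proof -
  define P where "P s t \<longleftrightarrow> (a \<le> s \<and> t \<le> b \<longrightarrow> norm (W t - W s) \<le> K t - K s)" for s t
  have "P a b"
    using \<open>a \<le> b\<close>
  proof (induct rule: Bolzano)
    case (trans r s t)
    show ?case
      unfolding P_def
    proof
      assume "a \<le> r \<and> t \<le> b"
      with trans have "norm (W s - W r) \<le> K s - K r" "norm (W t - W s) \<le> K t - K s"
        by (auto simp: P_def)
      with norm_triangle_ineq[of "W t - W s" "W s - W r"] show "norm (W t - W r) \<le> K t - K r"
        by simp
    qed
  next
    case (local x)
    with local_le[of x] show ?case
      unfolding P_def atLeastAtMost_iff by meson
  qed
  then show ?thesis by (simp add: P_def)
qed

lemma eq_if_increments_locally_small:
  fixes W :: "real \<Rightarrow> 'a::real_normed_vector" and K :: "real \<Rightarrow> real"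
  assumes "a \<le> b"
    and small: "\<And>e x. e > 0 \<Longrightarrow> x \<in> {a..b} \<Longrightarrow>
      \<exists>d>0. \<forall>s t. a \<le> s \<and> s \<le> x \<and> x \<le> t \<and> t \<le> b \<and> t - s < d \<longrightarrow> norm (W t - W s) \<le> e * (K t - K s)"
  shows "W b = W a"
proof -
  have increment_le: "norm (W b - W a) \<le> e * (K b - K a)" if "e > 0" for e
    using increment_le_if_locally_increment_le[OF \<open>a \<le> b\<close>, of W "\<lambda>t. e * K t"] small[OF that]
    by (simp add: right_diff_distrib)
  have "norm (W b - W a) \<le> 0 + e" if "e > 0" for e
  proof (cases "K b - K a \<le> 0")
    case True
    then show ?thesis using increment_le[OF zero_less_one] that by simp
  next
    case False
    then show ?thesis using increment_le[of "e / (K b - K a)"] that by simp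
  qed
  then have "norm (W b - W a) \<le> 0" by (rule field_le_epsilon)
  then show ?thesis by simp
qed

lemma primitive_on_compose_locally_small:
  fixes f F \<phi> \<phi>' :: "real \<Rightarrow> real"
  assumes F: "primitive_on a b f F"
    and deriv: "\<And>z. (\<phi> has_real_derivative \<phi>' z) (at z)" and cont: "continuous_on UNIV \<phi>'"
    and int: "set_integrable lborel {a<..b} (\<lambda>u. f u * \<phi>' (F u))"
    and "e > 0" and x: "x \<in> {a..b}"
  obtains d where "d > 0" "\<And>s t. a \<le> s \<Longrightarrow> s \<le> x \<Longrightarrow> x \<le> t \<Longrightarrow> t \<le> b \<Longrightarrow> t - s < d \<Longrightarrow>
    \<bar>\<phi> (F t) - \<phi> (F s) - (LBINT u:{s<..t}. f u * \<phi>' (F u))\<bar> \<le> e * (LBINT u:{s<..t}. \<bar>f u\<bar>)"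
proof -
  have "isCont \<phi>' (F x)" using cont by (simp add: continuous_on_eq_continuous_at)
  then obtain \<eta> where \<eta>: "\<eta> > 0" "\<And>z. dist z (F x) < \<eta> \<Longrightarrow> dist (\<phi>' z) (\<phi>' (F x)) < e / 2"
    unfolding continuous_at_eps_delta using half_gt_zero[OF \<open>e > 0\<close>] by blast
  obtain d where d: "d > 0" "\<And>u. u \<in> {a..b} \<Longrightarrow> dist u x < d \<Longrightarrow> dist (F u) (F x) < \<eta>"
    using continuous_on_primitive[OF F] x \<open>\<eta> > 0\<close> unfolding continuous_on_iff by metis
  have "\<bar>\<phi> (F t) - \<phi> (F s) - (LBINT u:{s<..t}. f u * \<phi>' (F u))\<bar> \<le> 2 * (e / 2) * (LBINT u:{s<..t}. \<bar>f u\<bar>)"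
    if st: "a \<le> s" "s \<le> x" "x \<le> t" "t \<le> b" "t - s < d" for s t
  proof (rule primitive_on_compose_increment_le[OF _ _ _ deriv])
    show "primitive_on s t f F" using F st(1,4) by (rule primitive_on_subinterval)
    show "set_integrable lborel {s<..t} (\<lambda>u. f u * \<phi>' (F u))"
      using st by (intro set_integrable_subset[OF int]) auto
    show "F u \<in> ball (F x) \<eta>" if "u \<in> {s..t}" for u
    proof -
      have "dist u x < d" using that st by (auto simp: dist_real_def)
      then show ?thesis using d(2)[of u] that st by (simp add: dist_commute)
    qed
    show "\<bar>\<phi>' z - \<phi>' (F x)\<bar> \<le> e / 2" if "z \<in> ball (F x) \<eta>" for z
      using \<eta>(2)[of z] that by (simp add: dist_commute dist_real_def)
  qed (use st in simp)
  with \<open>d > 0\<close> show ?thesis by (intro that) simp_all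
qed

lemma primitive_on_compose:
  fixes f F \<phi> \<phi>' :: "real \<Rightarrow> real"
  assumes F: "primitive_on a b f F"
    and deriv: "\<And>z. (\<phi> has_real_derivative \<phi>' z) (at z)" and cont: "continuous_on UNIV \<phi>'"
  shows "primitive_on a b (\<lambda>u. f u * \<phi>' (F u)) (\<lambda>t. \<phi> (F t))"
proof (rule primitive_onI)
  have f: "set_integrable lborel {a<..b} f" using F by (simp add: primitive_on_def)
  have "continuous_on {a..b} (\<lambda>u. \<phi>' (F u))"
    using cont continuous_on_primitive[OF F] by (rule continuous_on_compose2) simp
  with f show int: "set_integrable lborel {a<..b} (\<lambda>u. f u * \<phi>' (F u))"
    by (rule set_integrable_mult_continuous)
  define I where "I t = (LBINT u:{a<..t}. f u * \<phi>' (F u))" for t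
  define K where "K t = (LBINT u:{a<..t}. \<bar>f u\<bar>)" for t
  have I: "primitive_on a b (\<lambda>u. f u * \<phi>' (F u)) I"
    unfolding I_def using int by (rule primitive_on_indefinite_integral)
  have K: "primitive_on a b (\<lambda>u. \<bar>f u\<bar>) K"
    unfolding K_def using set_integrable_abs[OF f] by (rule primitive_on_indefinite_integral)
  fix t assume t: "t \<in> {a..b}"
  have "\<phi> (F t) - I t = \<phi> (F a) - I a"
  proof (rule eq_if_increments_locally_small[where W = "\<lambda>t. \<phi> (F t) - I t" and K = K])
    fix e x :: real assume "e > 0" "x \<in> {a..t}"
    then have "x \<in> {a..b}" using t by simp
    obtain d where d: "d > 0" "\<And>s r. a \<le> s \<Longrightarrow> s \<le> x \<Longrightarrow> x \<le> r \<Longrightarrow> r \<le> b \<Longrightarrow> r - s < d \<Longrightarrow>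
        \<bar>\<phi> (F r) - \<phi> (F s) - (LBINT u:{s<..r}. f u * \<phi>' (F u))\<bar> \<le> e * (LBINT u:{s<..r}. \<bar>f u\<bar>)"
      using primitive_on_compose_locally_small[OF F deriv cont int \<open>e > 0\<close> \<open>x \<in> {a..b}\<close>] by blast
    have "norm ((\<phi> (F r) - I r) - (\<phi> (F s) - I s)) \<le> e * (K r - K s)"
      if "a \<le> s" "s \<le> x" "x \<le> r" "r \<le> t" "r - s < d" for s r
      using d(2)[of s r] primitive_on_increment[OF I, of s r] primitive_on_increment[OF K, of s r] that t
      by (simp add: algebra_simps)
    with \<open>d > 0\<close> show "\<exists>d>0. \<forall>s r. a \<le> s \<and> s \<le> x \<and> x \<le> r \<and> r \<le> t \<and> r - s < d \<longrightarrow>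
        norm ((\<phi> (F r) - I r) - (\<phi> (F s) - I s)) \<le> e * (K r - K s)" by blast
  qed (use t in simp)
  then show "\<phi> (F t) - \<phi> (F a) = (LBINT u:{a<..t}. f u * \<phi>' (F u))"
    using primitive_on_increment[OF I, of a t] t by simp
qed

lemma primitive_on_mult:
  fixes f g F G :: "real \<Rightarrow> real"
  assumes F: "primitive_on a b f F" and G: "primitive_on a b g G"
  shows "primitive_on a b (\<lambda>u. f u * G u + F u * g u) (\<lambda>t. F t * G t)"
proof -
  have square: "primitive_on a b (\<lambda>u. h u * (2 * H u)) (\<lambda>t. (H t)\<^sup>2)" if "primitive_on a b h H" for h H :: "real \<Rightarrow> real"
    using that by (rule primitive_on_compose[where \<phi> = "\<lambda>z. z\<^sup>2"])
      (auto intro!: derivative_eq_intros continuous_intros)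
  have minus_G: "primitive_on a b (\<lambda>u. - g u) (\<lambda>t. - G t)"
    using primitive_on_scaleR[OF G, of "-1"] by simp
  have minus_square: "primitive_on a b (\<lambda>u. - ((f u - g u) * (2 * (F u - G u)))) (\<lambda>t. - (F t - G t)\<^sup>2)"
    using primitive_on_scaleR[OF square[OF primitive_on_add[OF F minus_G]], of "-1"] by simp
  from primitive_on_scaleR[OF primitive_on_add[OF square[OF primitive_on_add[OF F G]] minus_square], of "1/4"]
  show ?thesis
    by (rule primitive_on_cong) (auto simp: power2_eq_square field_simps)
qed

section \<open>Variation of constants with jumps\<close>

lemma primitive_on_finite_gaps:
  assumes "finite (J \<inter> {a<..<b})" "a \<le> b"
    and "\<And>s t. a \<le> s \<Longrightarrow> s \<le> t \<Longrightarrow> t \<le> b \<Longrightarrow> J \<inter> {s<..<t} = {} \<Longrightarrow> primitive_on s t f F"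
  shows "primitive_on a b f F"
  using assms
proof (induction "card (J \<inter> {a<..<b})" arbitrary: a b rule: less_induct)
  case less
  show ?case
  proof (cases "J \<inter> {a<..<b} = {}")
    case True
    with less.prems show ?thesis by blast
  next
    case False
    then obtain u where u: "u \<in> J" "a < u" "u < b" by auto
    then have sub: "J \<inter> {a<..<u} \<subset> J \<inter> {a<..<b}" "J \<inter> {u<..<b} \<subset> J \<inter> {a<..<b}"
      by auto
    have "primitive_on a u f F"
      by (rule less.hyps[OF psubset_card_mono[OF less.prems(1) sub(1)]
            finite_subset[OF psubset_imp_subset[OF sub(1)] less.prems(1)]])
        (use u less.prems(3) in simp_all)
    moreover have "primitive_on u b f F"
      by (rule less.hyps[OF psubset_card_mono[OF less.prems(1) sub(2)]
            finite_subset[OF psubset_imp_subset[OF sub(2)] less.prems(1)]])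
        (use u less.prems(3) in simp_all)
    ultimately show ?thesis by (rule primitive_on_trans) (use u in auto)
  qed
qed

lemma Int_Ioc_gap:
  fixes J :: "real set"
  assumes "J \<inter> {s<..<t} = {}" "a \<le> s" "r \<in> {s..<t}"
  shows "J \<inter> {a<..r} = J \<inter> {a<..s}"
  using assms by force

lemma Int_Ioc_extend_gap:
  fixes J :: "real set"
  assumes "J \<inter> {s<..<t} = {}" "a \<le> s" "s < t"
  shows "J \<inter> {a<..t} = (if t \<in> J then insert t (J \<inter> {a<..s}) else J \<inter> {a<..s})"
proof -
  have "{a<..t} = insert t ({a<..s} \<union> {s<..<t})" using assms(2,3) by auto
  with assms(1) show ?thesis by (simp add: Int_Un_distrib)
qed

lemma
  fixes x c g :: "real \<Rightarrow> real"
  assumes x: "primitive_on a b g (\<lambda>t. x t - (\<Sum>u\<in>J \<inter> {a<..t}. c u))" and fin: "finite (J \<inter> {a<..b})"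
    and st: "a \<le> s" "s < t" "t \<le> b" and gap: "J \<inter> {s<..<t} = {}"
  shows left_lim_after_gap: "left_lim x t = x s + (LBINT u:{s<..t}. g u)"
    and jump_after_gap: "x t = left_lim x t + (if t \<in> J then c t else 0)"
proof -
  define S where "S r = (\<Sum>u\<in>J \<inter> {a<..r}. c u)" for r
  have S_const: "S r = S s" if "r \<in> {s..<t}" for r
    by (simp add: S_def Int_Ioc_gap[OF gap st(1) that])
  have "finite (J \<inter> {a<..s})"
    using st by (intro finite_subset[OF _ fin]) auto
  then have S_jump: "S t = S s + (if t \<in> J then c t else 0)"
    unfolding S_def Int_Ioc_extend_gap[OF gap st(1,2)] using st(2) by simp
  have "continuous_on {a..b} (\<lambda>r. x r - S r)"
    using continuous_on_primitive[OF x] by (simp add: S_def)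
  then have "continuous_on {s..t} (\<lambda>r. x r - S r)"
    by (rule continuous_on_subset) (use st in auto)
  then have "((\<lambda>r. x r - S r) \<longlongrightarrow> x t - S t) (at_left t)"
    using st(2) by (auto simp: continuous_on_def at_within_Icc_at_left dest: bspec[where x = t])
  then have "((\<lambda>r. x r - S r + S s) \<longlongrightarrow> x t - S t + S s) (at_left t)"
    by (rule tendsto_add[OF _ tendsto_const])
  moreover have "\<forall>\<^sub>F r in at_left t. x r - S r + S s = x r"
    unfolding eventually_at_left[OF st(2)]
  proof (intro exI[of _ s] conjI allI impI)
    fix r assume "s < r" "r < t"
    with S_const[of r] show "x r - S r + S s = x r" by simp
  qed fact
  ultimately have "(x \<longlongrightarrow> x t - S t + S s) (at_left t)"
    by (rule Lim_transform_eventually)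
  then have left_lim: "left_lim x t = x t - S t + S s" by (rule left_lim_eq)
  with S_jump show "x t = left_lim x t + (if t \<in> J then c t else 0)" by simp
  show "left_lim x t = x s + (LBINT u:{s<..t}. g u)"
    using primitive_on_increment[OF x, of s t] st left_lim by (simp add: S_def)
qed

lemma
  fixes x g m :: "real \<Rightarrow> real" and J :: "real set" and a :: real
  defines "P \<equiv> \<lambda>t. \<Prod>u\<in>J \<inter> {a<..t}. m u"
  assumes x: "primitive_on a b g (\<lambda>t. x t - (\<Sum>u\<in>J \<inter> {a<..t}. (m u - 1) * left_lim x u))"
    and fin: "finite (J \<inter> {a<..b})" and m: "\<And>u. u \<in> J \<inter> {a<..b} \<Longrightarrow> m u \<noteq> 0"
    and st: "a \<le> s" "s < t" "t \<le> b" and gap: "J \<inter> {s<..<t} = {}"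
  shows set_integrable_divide_jump_product: "set_integrable lborel {s<..t} (\<lambda>u. g u / P u)"
    and divide_jump_product_increment: "x t / P t - x s / P s = (LBINT u:{s<..t}. g u / P u)"
proof -
  have P_eq: "P u = P s" if "u \<in> {s..<t}" for u
    by (simp add: P_def Int_Ioc_gap[OF gap st(1) that])
  have "{u \<in> {s<..t}. g u / P s \<noteq> g u / P u} \<subseteq> {t}"
  proof safe
    fix u assume "u \<in> {s<..t}" "g u / P s \<noteq> g u / P u"
    with P_eq[of u] show "u = t" by fastforce
  qed
  then have spike: "countable {u \<in> {s<..t}. g u / P s \<noteq> g u / P u}"
    by (rule countable_subset) simp
  have "set_integrable lborel {s<..t} (\<lambda>u. g u / P s)"
    using primitive_on_set_integrable[OF x st(1,3)] by simp
  then show "set_integrable lborel {s<..t} (\<lambda>u. g u / P u)"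
    by (simp only: set_integrable_cong_countable[OF spike])
  have "finite (J \<inter> {a<..s})" using st by (intro finite_subset[OF _ fin]) auto
  then have "P t = (if t \<in> J then m t else 1) * P s"
    unfolding P_def Int_Ioc_extend_gap[OF gap st(1,2)] using st(2) by simp
  moreover have "x t = (if t \<in> J then m t else 1) * left_lim x t"
    using jump_after_gap[OF x fin st gap] by (simp add: algebra_simps)
  moreover have "t \<in> J \<Longrightarrow> m t \<noteq> 0" using m st by simp
  ultimately have "x t / P t = left_lim x t / P s" by simp
  also have "\<dots> = x s / P s + (LBINT u:{s<..t}. g u / P s)"
    using left_lim_after_gap[OF x fin st gap] by (simp add: add_divide_distrib)
  also have "(LBINT u:{s<..t}. g u / P s) = (LBINT u:{s<..t}. g u / P u)"
    by (rule set_lebesgue_integral_cong_countable[OF spike])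
  finally show "x t / P t - x s / P s = (LBINT u:{s<..t}. g u / P u)" by simp
qed

lemma primitive_on_divide_jump_product:
  fixes x g m :: "real \<Rightarrow> real" and J :: "real set" and a :: real
  defines "P \<equiv> \<lambda>t. \<Prod>u\<in>J \<inter> {a<..t}. m u"
  assumes x: "primitive_on a b g (\<lambda>t. x t - (\<Sum>u\<in>J \<inter> {a<..t}. (m u - 1) * left_lim x u))"
    and fin: "finite (J \<inter> {a<..b})" and m: "\<And>u. u \<in> J \<inter> {a<..b} \<Longrightarrow> m u \<noteq> 0" and "a \<le> b"
  shows "primitive_on a b (\<lambda>u. g u / P u) (\<lambda>t. x t / P t)"
proof (rule primitive_on_finite_gaps)
  show "finite (J \<inter> {a<..<b})" by (rule finite_subset[OF _ fin]) auto
  fix s t assume st: "a \<le> s" "s \<le> t" "t \<le> b" and gap: "J \<inter> {s<..<t} = {}"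
  show "primitive_on s t (\<lambda>u. g u / P u) (\<lambda>t. x t / P t)"
  proof (rule primitive_onI)
    show "set_integrable lborel {s<..t} (\<lambda>u. g u / P u)"
      using set_integrable_divide_jump_product[OF x fin m st(1) _ st(3) gap] st(2)
      by (cases "s = t") (simp_all add: P_def)
    fix r assume r: "r \<in> {s..t}"
    have gap_r: "J \<inter> {s<..<r} = {}" using gap r by auto
    show "x r / P r - x s / P s = (LBINT u:{s<..r}. g u / P u)"
      using divide_jump_product_increment[OF x fin m st(1) _ _ gap_r] r st(3)
      by (cases "s = r") (simp_all add: P_def set_lebesgue_integral_def)
  qed
qed fact

definition jump_exponential :: "real \<Rightarrow> (real \<Rightarrow> real) \<Rightarrow> (real \<Rightarrow> real) \<Rightarrow> real set \<Rightarrow> real \<Rightarrow> real" where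
  "jump_exponential a h m J t = exp (LBINT u:{a<..t}. h u) * (\<Prod>u\<in>J \<inter> {a<..t}. m u)"

lemma jump_exponential_nonzero:
  assumes "\<And>u. u \<in> J \<inter> {a<..t} \<Longrightarrow> m u \<noteq> 0" "finite (J \<inter> {a<..t})"
  shows "jump_exponential a h m J t \<noteq> 0"
  using assms by (simp add: jump_exponential_def)

lemma inverse_jump_exponential:
  "inverse (jump_exponential a h m J t) = jump_exponential a (\<lambda>u. - h u) (\<lambda>u. inverse (m u)) J t"
  using prod_inversef[of m "J \<inter> {a<..t}"]
  by (simp add: jump_exponential_def set_lebesgue_integral_minus exp_minus comp_def)

lemma variation_of_constants:
  fixes x f h m :: "real \<Rightarrow> real" and J :: "real set" and a :: real
  defines "E \<equiv> jump_exponential a h m J"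
  assumes "a \<le> b" "finite (J \<inter> {a<..b})" "\<And>u. u \<in> J \<inter> {a<..b} \<Longrightarrow> m u \<noteq> 0"
    and h: "set_integrable lborel {a<..b} h"
    and x: "primitive_on a b (\<lambda>u. h u * x u + f u) (\<lambda>t. x t - (\<Sum>u\<in>J \<inter> {a<..t}. (m u - 1) * left_lim x u))"
  shows "primitive_on a b (\<lambda>u. f u / E u) (\<lambda>t. x t / E t)"
proof -
  define H where "H t = (LBINT u:{a<..t}. h u)" for t
  define P where "P t = (\<Prod>u\<in>J \<inter> {a<..t}. m u)" for t
  have E: "E t = exp (H t) * P t" for t by (simp add: E_def jump_exponential_def H_def P_def)
  have "primitive_on a b h H"
    unfolding H_def using h by (rule primitive_on_indefinite_integral)
  then have "primitive_on a b (\<lambda>u. h u * - exp (- H u)) (\<lambda>t. exp (- H t))"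
    by (rule primitive_on_compose[where \<phi> = "\<lambda>z. exp (- z)"])
      (auto intro!: derivative_eq_intros continuous_intros)
  moreover have "primitive_on a b (\<lambda>u. (h u * x u + f u) / P u) (\<lambda>t. x t / P t)"
    unfolding P_def using x assms(2-4) by (intro primitive_on_divide_jump_product)
  ultimately have "primitive_on a b
      (\<lambda>u. h u * - exp (- H u) * (x u / P u) + exp (- H u) * ((h u * x u + f u) / P u))
      (\<lambda>t. exp (- H t) * (x t / P t))"
    by (rule primitive_on_mult)
  then show ?thesis
    by (rule primitive_on_cong) (simp_all add: E exp_minus field_simps add_divide_distrib)
qed

section \<open>Diagonal systems\<close>

lemma
  fixes A :: "'a::semiring_1^'n^'m"
  assumes "invertible A"
  shows matrix_inv_right: "A ** matrix_inv A = mat 1" and matrix_inv_left: "matrix_inv A ** A = mat 1"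
  using someI_ex[OF assms[unfolded invertible_def]] by (simp_all add: matrix_inv_def)

lemma matrix_inv_unique:
  fixes A :: "'a::comm_semiring_1^'n^'m" and B :: "'a^'m^'n"
  assumes "A ** B = mat 1" "B ** A = mat 1"
  shows "matrix_inv A = B"
proof -
  have "invertible A" using assms by (auto simp: invertible_def)
  have "matrix_inv A = (B ** A) ** matrix_inv A" using assms by simp
  also have "\<dots> = B" by (simp add: matrix_inv_right[OF \<open>invertible A\<close>] flip: matrix_mul_assoc)
  finally show ?thesis .
qed

lemma conjugate_matrix_vector_mult:
  fixes E M :: "real^'n^'n"
  assumes "invertible E"
  shows "(matrix_inv E ** M ** E) *v (matrix_inv E *v x) = matrix_inv E *v (M *v x)"
proof -
  have "(matrix_inv E ** M ** E) *v (matrix_inv E *v x) = matrix_inv E *v (M *v ((E ** matrix_inv E) *v x))"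
    by (simp only: matrix_vector_mul_assoc matrix_mul_assoc)
  then show ?thesis by (simp add: matrix_inv_right[OF assms])
qed

lemma diagm_mult_vector_nth: "(diagm d *v x) $ i = d $ i * x $ i"
  by (simp add: diagm_def matrix_vector_mult_def if_distrib[of "\<lambda>c. c * _"] cong: if_cong)

lemma diagm_mult_diagm: "diagm c ** diagm d = diagm (\<chi> i. c $ i * d $ i)"
  by (simp add: matrix_eq vec_eq_iff diagm_mult_vector_nth flip: matrix_vector_mul_assoc)

lemma mat_1_eq_diagm: "mat 1 = diagm (\<chi> i. 1)"
  by (simp add: diagm_def mat_def vec_eq_iff)

lemma
  assumes "\<And>i. d $ i \<noteq> 0"
  shows matrix_inv_diagm: "matrix_inv (diagm d) = diagm (\<chi> i. inverse (d $ i))"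
    and invertible_diagm: "invertible (diagm d)"
proof -
  have "diagm d ** diagm (\<chi> i. inverse (d $ i)) = mat 1" "diagm (\<chi> i. inverse (d $ i)) ** diagm d = mat 1"
    using assms by (simp_all add: diagm_mult_diagm mat_1_eq_diagm)
  then show "matrix_inv (diagm d) = diagm (\<chi> i. inverse (d $ i))" "invertible (diagm d)"
    by (auto simp: invertible_def intro: matrix_inv_unique)
qed

lemma inner_diagm_mult: "(diagm d *v x) \<bullet> y = x \<bullet> (diagm d *v y)"
  by (simp add: inner_vec_def diagm_mult_vector_nth mult.left_commute mult.assoc)

lemma set_integrable_diagm:
  assumes "\<And>i. set_integrable M S (d i)"
  shows "set_integrable M S (\<lambda>u. diagm (\<chi> i. d i u))"
proof -
  have "diagm (\<chi> i. d i u) $ i $ j = (if i = j then d i u else 0)" for i j u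
    by (simp add: diagm_def)
  moreover have "set_integrable M S (\<lambda>u. if i = j then d i u else 0)" for i j
    using assms by (cases "i = j") (simp_all add: set_integrable_def)
  ultimately show ?thesis by (simp add: set_integrable_vec_iff)
qed

lemma set_integrable_transpose:
  fixes A :: "'a \<Rightarrow> real^'n^'m"
  assumes "set_integrable M S A"
  shows "set_integrable M S (\<lambda>u. transpose (A u))"
  using assms by (simp add: set_integrable_vec_iff transpose_def)

lemma left_lim_vec_nth:
  fixes x :: "real \<Rightarrow> 'b::metric_space^'n"
  assumes "cadlag_on a b x" "t \<in> {a<..b}"
  shows "left_lim (\<lambda>s. x s $ i) t = left_lim x t $ i"
  by (intro left_lim_eq tendsto_vec_nth cadlag_on_tendsto_left_lim[OF assms])

lemma diagonal_variation_of_constants: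
  fixes x f :: "real \<Rightarrow> real^'n" and h m :: "'n \<Rightarrow> real \<Rightarrow> real" and J :: "real set" and a :: real
  defines "E \<equiv> \<lambda>t. diagm (\<chi> i. jump_exponential a (h i) (m i) J t)"
  assumes "a \<le> b" and J: "finite (J \<inter> {a<..b})"
    and m: "\<And>i u. u \<in> J \<inter> {a<..b} \<Longrightarrow> m i u \<noteq> 0"
    and h: "\<And>i. set_integrable lborel {a<..b} (h i)" and cadlag: "cadlag_on a b x"
    and x: "primitive_on a b (\<lambda>u. diagm (\<chi> i. h i u) *v x u + f u)
      (\<lambda>t. x t - (\<Sum>u\<in>J \<inter> {a<..t}. (diagm (\<chi> i. m i u) - mat 1) *v left_lim x u))"
  shows "primitive_on a b (\<lambda>u. matrix_inv (E u) *v f u) (\<lambda>t. matrix_inv (E t) *v x t)"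
proof -
  define e where "e i t = jump_exponential a (h i) (m i) J t" for i t
  have "e i t \<noteq> 0" if "t \<in> {a..b}" for i t
    unfolding e_def using that m by (intro jump_exponential_nonzero finite_subset[OF _ J]) auto
  then have inverse_E: "(matrix_inv (E t) *v w) $ i = w $ i / e i t" if "t \<in> {a..b}" for t w i
    using that unfolding E_def e_def[symmetric]
    by (subst matrix_inv_diagm) (simp_all add: diagm_mult_vector_nth field_simps)
  have "primitive_on a b (\<lambda>u. f u $ i / e i u) (\<lambda>t. x t $ i / e i t)" for i
    unfolding e_def
  proof (rule variation_of_constants[OF \<open>a \<le> b\<close> J m h])
    from x have "primitive_on a b (\<lambda>u. (diagm (\<chi> i. h i u) *v x u + f u) $ i)
        (\<lambda>t. (x t - (\<Sum>u\<in>J \<inter> {a<..t}. (diagm (\<chi> i. m i u) - mat 1) *v left_lim x u)) $ i)"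
      unfolding primitive_on_vec_iff by blast
    then show "primitive_on a b (\<lambda>u. h i u * x u $ i + f u $ i)
        (\<lambda>t. x t $ i - (\<Sum>u\<in>J \<inter> {a<..t}. (m i u - 1) * left_lim (\<lambda>s. x s $ i) u))"
      by (rule primitive_on_cong)
        (simp_all add: diagm_mult_vector_nth matrix_vector_mult_diff_rdistrib sum_component
          left_lim_vec_nth[OF cadlag] left_diff_distrib)
  qed
  then have "primitive_on a b (\<lambda>u. (matrix_inv (E u) *v f u) $ i) (\<lambda>t. (matrix_inv (E t) *v x t) $ i)" for i
    by (rule primitive_on_cong) (simp_all add: inverse_E)
  then show ?thesis by (simp add: primitive_on_vec_iff)
qed

section \<open>Filter and smoother of a counting process\<close>

lemma dY_eq_0_if_constant:
  assumes "mono_on {0..} y" "0 \<le> r" "r < u" "y r = y u"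
  shows "dY y u = 0"
proof -
  have "y s = y u" if "r < s" "s < u" for s
    using mono_onD[OF assms(1), of r s] mono_onD[OF assms(1), of s u] assms(2,4) that by simp
  then have "\<forall>\<^sub>F s in at_left u. real (y s) = real (y u)"
    unfolding eventually_at_left[OF assms(3)] using assms(3) by auto
  from left_lim_eq[OF tendsto_eventually[OF this]] show ?thesis by (simp add: dY_def)
qed

definition jumps :: "(real \<Rightarrow> nat) \<Rightarrow> real set" where
  "jumps y = {u. dY y u \<noteq> 0}"

lemma jump_times_eq_jumps: "jump_times y a b = jumps y \<inter> {a<..b}"
  by (auto simp: jump_times_def jumps_def)

lemma finite_jumps:
  assumes "counting_path y"
  shows "finite (jumps y \<inter> {0<..b})"
proof (rule finite_imageD)
  have mono: "mono_on {0..} y" using assms by (simp add: counting_path_def)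
  have "y ` (jumps y \<inter> {0<..b}) \<subseteq> {..y b}"
    using mono_onD[OF mono] by auto
  then show "finite (y ` (jumps y \<inter> {0<..b}))" by (rule finite_subset) simp
  show "inj_on y (jumps y \<inter> {0<..b})"
  proof (rule linorder_inj_onI)
    fix r u assume "r < u" "r \<in> jumps y \<inter> {0<..b}" "u \<in> jumps y \<inter> {0<..b}"
    then show "y r \<noteq> y u"
      using dY_eq_0_if_constant[OF mono, of r u] by (auto simp: jumps_def)
  qed auto
qed

lemma dY_eq_1:
  assumes "counting_path y" "u \<in> jumps y" "0 < u"
  shows "dY y u = 1"
  using assms by (auto simp: counting_path_def jumps_def)
locale counting_intensity =
  fixes lam :: "'n::finite \<Rightarrow> real \<Rightarrow> real" and y :: "real \<Rightarrow> nat" and T :: real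
  assumes T_nonneg: "0 \<le> T" and counting_path: "counting_path y"
    and lam_pos: "\<And>i t. 0 \<le> t \<Longrightarrow> 0 < lam i t"
    and lam_integrable: "\<And>i. set_integrable lborel {0<..T} (lam i)"
begin

abbreviation "\<Lambda> \<equiv> Lam lam"
abbreviation "\<Gamma> \<equiv> Gamma lam y"

lemma lam_nonzero: "0 \<le> t \<Longrightarrow> lam i t \<noteq> 0"
  using lam_pos[of t i] by simp

lemma const_integrable: "set_integrable lborel {0<..T} (\<lambda>_. c :: 'b::{banach, second_countable_topology})"
  using T_nonneg by (simp add: set_integrable_def)

lemma Gamma_eq_jump_exponential:
  "\<Gamma> t = diagm (\<chi> i. jump_exponential 0 (\<lambda>u. 1 - lam i u) (lam i) (jumps y) t)"
proof -
  have "(\<Prod>u\<in>jumps y \<inter> {0<..t}. lam i u powr dY y u) = (\<Prod>u\<in>jumps y \<inter> {0<..t}. lam i u)" for i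
    using lam_pos by (intro prod.cong) (auto simp: dY_eq_1[OF counting_path] less_imp_le)
  moreover have "- (LBINT u:{0<..t}. lam i u - 1) = (LBINT u:{0<..t}. 1 - lam i u)" for i
    by (simp flip: set_lebesgue_integral_minus)
  ultimately show ?thesis
    by (simp add: Gamma_def jump_exponential_def jump_times_eq_jumps)
qed

lemma Gamma_diagonal_nonzero: "jump_exponential 0 (\<lambda>u. 1 - lam i u) (lam i) (jumps y) t \<noteq> 0"
  by (intro jump_exponential_nonzero finite_jumps counting_path) (use lam_nonzero in auto)

lemma invertible_Gamma: "invertible (\<Gamma> t)"
  unfolding Gamma_eq_jump_exponential by (intro invertible_diagm) (simp add: Gamma_diagonal_nonzero)

lemma matrix_inv_Gamma:
  "matrix_inv (\<Gamma> t) =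
    diagm (\<chi> i. jump_exponential 0 (\<lambda>u. lam i u - 1) (\<lambda>u. inverse (lam i u)) (jumps y) t)"
  unfolding Gamma_eq_jump_exponential
  by (subst matrix_inv_diagm) (simp_all add: Gamma_diagonal_nonzero inverse_jump_exponential)

lemma inner_Gamma: "(matrix_inv (\<Gamma> t) *v x) \<bullet> (\<Gamma> t *v z) = x \<bullet> z"
proof -
  have "(matrix_inv (\<Gamma> t) *v x) \<bullet> (\<Gamma> t *v z) = x \<bullet> (matrix_inv (\<Gamma> t) *v (\<Gamma> t *v z))"
    by (simp only: matrix_inv_Gamma inner_diagm_mult)
  then show ?thesis
    by (simp add: matrix_vector_mul_assoc matrix_inv_left[OF invertible_Gamma])
qed

lemma matrix_inv_Lam:
  assumes "0 \<le> t"
  shows "matrix_inv (\<Lambda> t) = diagm (\<chi> i. inverse (lam i t))"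
  unfolding Lam_def using lam_nonzero[OF assms] by (subst matrix_inv_diagm) simp_all

lemma Lam_integrable: "set_integrable lborel {0<..T} \<Lambda>"
  unfolding Lam_def[abs_def] using lam_integrable by (rule set_integrable_diagm)

definition filter_equation :: "(real \<Rightarrow> real^'n^'n) \<Rightarrow> (real \<Rightarrow> real^'n) \<Rightarrow> bool" where
  "filter_equation A q \<longleftrightarrow> (\<forall>t\<in>{0..T}. q t = q 0
    + (\<Sum>u\<in>jump_times y 0 t. dY y u *\<^sub>R ((\<Lambda> u - mat 1) *v left_lim q u))
    - (LBINT u:{0<..t}. (\<Lambda> u - mat 1) *v left_lim q u) + (LBINT u:{0<..t}. A u *v q u))"

definition smoother_equation :: "(real \<Rightarrow> real^'n^'n) \<Rightarrow> real^'n \<Rightarrow> (real \<Rightarrow> real^'n) \<Rightarrow> bool" where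
  "smoother_equation A c v \<longleftrightarrow> (\<forall>t\<in>{0..T}. v t = c
    + (LBINT u:{t<..T}. (transpose (A u) - \<Lambda> u + mat 1) *v left_lim v u)
    - (\<Sum>u\<in>jump_times y t T. dY y u *\<^sub>R ((matrix_inv (\<Lambda> u) - mat 1) *v left_lim v u)))"

lemma filter_jump_equation:
  assumes A: "set_integrable lborel {0<..T} A" and q: "cadlag_on 0 T q"
    and filter_eq: "filter_equation A q"
  shows "primitive_on 0 T (\<lambda>u. diagm (\<chi> i. 1 - lam i u) *v q u + A u *v q u)
    (\<lambda>t. q t - (\<Sum>u\<in>jumps y \<inter> {0<..t}. (\<Lambda> u - mat 1) *v left_lim q u))"
proof (rule primitive_on_cong_countable)
  have Aq: "set_integrable lborel {0<..T} (\<lambda>u. A u *v q u)"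
    by (rule set_integrable_cadlag_bilinear[OF bounded_bilinear_matrix_vector_mult A q])
  have Lq: "set_integrable lborel {0<..T} (\<lambda>u. (\<Lambda> u - mat 1) *v left_lim q u)"
    by (intro set_integrable_left_lim_bilinear[OF bounded_bilinear_matrix_vector_mult _ q]
        set_integral_diff Lam_integrable const_integrable)
  show "primitive_on 0 T (\<lambda>u. A u *v q u - (\<Lambda> u - mat 1) *v left_lim q u)
      (\<lambda>t. q t - (\<Sum>u\<in>jump_times y 0 t. dY y u *\<^sub>R ((\<Lambda> u - mat 1) *v left_lim q u)))"
  proof (rule primitive_onI)
    show "set_integrable lborel {0<..T} (\<lambda>u. A u *v q u - (\<Lambda> u - mat 1) *v left_lim q u)"
      using Aq Lq by (rule set_integral_diff)
    fix t assume t: "t \<in> {0..T}"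
    then have "set_integrable lborel {0<..t} (\<lambda>u. A u *v q u)"
        "set_integrable lborel {0<..t} (\<lambda>u. (\<Lambda> u - mat 1) *v left_lim q u)"
      by (auto intro: set_integrable_subset[OF Aq] set_integrable_subset[OF Lq])
    then have "(LBINT u:{0<..t}. A u *v q u - (\<Lambda> u - mat 1) *v left_lim q u)
        = (LBINT u:{0<..t}. A u *v q u) - (LBINT u:{0<..t}. (\<Lambda> u - mat 1) *v left_lim q u)"
      by (rule set_integral_diff)
    with filter_eq[unfolded filter_equation_def, THEN bspec, OF t]
    show "q t - (\<Sum>u\<in>jump_times y 0 t. dY y u *\<^sub>R ((\<Lambda> u - mat 1) *v left_lim q u))
        - (q 0 - (\<Sum>u\<in>jump_times y 0 0. dY y u *\<^sub>R ((\<Lambda> u - mat 1) *v left_lim q u)))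
        = (LBINT u:{0<..t}. A u *v q u - (\<Lambda> u - mat 1) *v left_lim q u)"
      by (simp add: jump_times_eq_jumps)
  qed
  have drift: "- ((\<Lambda> u - mat 1) *v q u) = diagm (\<chi> i. 1 - lam i u) *v q u" for u
    by (simp add: Lam_def vec_eq_iff diagm_mult_vector_nth matrix_vector_mult_diff_rdistrib algebra_simps)
  show "countable {u \<in> {0<..T}. A u *v q u - (\<Lambda> u - mat 1) *v left_lim q u
      \<noteq> diagm (\<chi> i. 1 - lam i u) *v q u + A u *v q u}"
    by (rule countable_subset[OF _ countable_left_lim_neq[OF q]]) (auto simp: drift)
  show "q t - (\<Sum>u\<in>jump_times y 0 t. dY y u *\<^sub>R ((\<Lambda> u - mat 1) *v left_lim q u))
      = q t - (\<Sum>u\<in>jumps y \<inter> {0<..t}. (\<Lambda> u - mat 1) *v left_lim q u)" for t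
    by (simp add: jump_times_eq_jumps dY_eq_1[OF counting_path])
qed

lemma smoother_jump_equation:
  assumes A: "set_integrable lborel {0<..T} A" and v: "cadlag_on 0 T v"
    and smoother_eq: "smoother_equation A c v"
  shows "primitive_on 0 T (\<lambda>u. diagm (\<chi> i. lam i u - 1) *v v u + - (transpose (A u) *v v u))
    (\<lambda>t. v t - (\<Sum>u\<in>jumps y \<inter> {0<..t}. (diagm (\<chi> i. inverse (lam i u)) - mat 1) *v left_lim v u))"
proof (rule primitive_on_cong_countable[OF primitive_on_backward_integral])
  define jump where "jump u = (diagm (\<chi> i. inverse (lam i u)) - mat 1) *v left_lim v u" for u
  show "set_integrable lborel {0<..T} (\<lambda>u. (transpose (A u) - \<Lambda> u + mat 1) *v left_lim v u)"
    by (intro set_integrable_left_lim_bilinear[OF bounded_bilinear_matrix_vector_mult _ v]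
        set_integral_diff set_integral_add set_integrable_transpose A Lam_integrable const_integrable)
  show "v t - (\<Sum>u\<in>jumps y \<inter> {0<..t}. jump u) = c - (\<Sum>u\<in>jumps y \<inter> {0<..T}. jump u)
      + (LBINT u:{t<..T}. (transpose (A u) - \<Lambda> u + mat 1) *v left_lim v u)" if t: "t \<in> {0..T}" for t
  proof -
    have "jumps y \<inter> {0<..T} = (jumps y \<inter> {0<..t}) \<union> (jumps y \<inter> {t<..T})" using t by auto
    moreover have "finite (jumps y \<inter> {t<..T})"
      using t by (intro finite_subset[OF _ finite_jumps[OF counting_path, of T]]) auto
    ultimately have "(\<Sum>u\<in>jumps y \<inter> {0<..T}. jump u)
        = (\<Sum>u\<in>jumps y \<inter> {0<..t}. jump u) + (\<Sum>u\<in>jumps y \<inter> {t<..T}. jump u)"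
      using finite_jumps[OF counting_path, of t] by (simp only:) (rule sum.union_disjoint; auto)
    moreover have "(\<Sum>u\<in>jump_times y t T. dY y u *\<^sub>R ((matrix_inv (\<Lambda> u) - mat 1) *v left_lim v u))
        = (\<Sum>u\<in>jumps y \<inter> {t<..T}. jump u)"
      using t by (intro sum.cong)
        (auto simp: jump_times_eq_jumps jump_def matrix_inv_Lam dY_eq_1[OF counting_path])
    ultimately show ?thesis using smoother_eq[unfolded smoother_equation_def, THEN bspec, OF t] by simp
  qed
  have drift: "- ((transpose (A u) - \<Lambda> u + mat 1) *v v u)
      = diagm (\<chi> i. lam i u - 1) *v v u + - (transpose (A u) *v v u)" for u
    by (simp add: Lam_def vec_eq_iff diagm_mult_vector_nth matrix_vector_mult_diff_rdistrib
        matrix_vector_mult_add_rdistrib algebra_simps)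
  show "countable {u \<in> {0<..T}. - ((transpose (A u) - \<Lambda> u + mat 1) *v left_lim v u)
      \<noteq> diagm (\<chi> i. lam i u - 1) *v v u + - (transpose (A u) *v v u)}"
    by (rule countable_subset[OF _ countable_left_lim_neq[OF v]]) (auto simp: drift)
qed (rule refl)

lemma filter_gauge_primitive:
  assumes "set_integrable lborel {0<..T} A" and q: "cadlag_on 0 T q" and "filter_equation A q"
  shows "primitive_on 0 T (\<lambda>u. (matrix_inv (\<Gamma> u) ** A u ** \<Gamma> u) *v (matrix_inv (\<Gamma> u) *v q u))
    (\<lambda>t. matrix_inv (\<Gamma> t) *v q t)"
  unfolding conjugate_matrix_vector_mult[OF invertible_Gamma] unfolding Gamma_eq_jump_exponential
proof (rule diagonal_variation_of_constants)
  show "primitive_on 0 T (\<lambda>u. diagm (\<chi> i. 1 - lam i u) *v q u + A u *v q u)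
      (\<lambda>t. q t - (\<Sum>u\<in>jumps y \<inter> {0<..t}. (diagm (\<chi> i. lam i u) - mat 1) *v left_lim q u))"
    using filter_jump_equation[OF assms] by (simp add: Lam_def)
qed (use T_nonneg finite_jumps[OF counting_path] lam_nonzero q in
    \<open>auto intro!: set_integral_diff(1) lam_integrable const_integrable\<close>)

lemma smoother_gauge_primitive:
  assumes "set_integrable lborel {0<..T} A" and v: "cadlag_on 0 T v" and "smoother_equation A c v"
  shows "primitive_on 0 T (\<lambda>u. - ((\<Gamma> u ** transpose (A u) ** matrix_inv (\<Gamma> u)) *v (\<Gamma> u *v v u)))
    (\<lambda>t. \<Gamma> t *v v t)"
proof -
  have inv_inv: "matrix_inv (matrix_inv (\<Gamma> t)) = \<Gamma> t" for t
    by (intro matrix_inv_unique matrix_inv_left matrix_inv_right invertible_Gamma)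
  have "invertible (matrix_inv (\<Gamma> t))" for t
    using matrix_inv_left[OF invertible_Gamma] matrix_inv_right[OF invertible_Gamma]
    by (auto simp: invertible_def)
  from conjugate_matrix_vector_mult[OF this]
  have conjugate: "(\<Gamma> u ** transpose (A u) ** matrix_inv (\<Gamma> u)) *v (\<Gamma> u *v v u)
      = \<Gamma> u *v (transpose (A u) *v v u)" for u
    by (simp add: inv_inv)
  have "primitive_on 0 T (\<lambda>u. matrix_inv (matrix_inv (\<Gamma> u)) *v (- (transpose (A u) *v v u)))
      (\<lambda>t. matrix_inv (matrix_inv (\<Gamma> t)) *v v t)"
    unfolding matrix_inv_Gamma
    by (rule diagonal_variation_of_constants[OF _ _ _ _ v smoother_jump_equation[OF assms]])
      (use T_nonneg finite_jumps[OF counting_path] lam_nonzero in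
        \<open>auto intro!: set_integral_diff(1) lam_integrable const_integrable\<close>)
  then show ?thesis
    by (simp add: conjugate inv_inv linear_neg[OF matrix_vector_mul_linear])
qed

end

theorem mainTheorem4:
  fixes A :: "real \<Rightarrow> real^'n^'n"
    and lam :: "'n \<Rightarrow> real \<Rightarrow> real"
    and y :: "real \<Rightarrow> nat"
    and q v :: "real \<Rightarrow> real^'n"
    and T :: real
  assumes T: "0 \<le> T"
    and A_rate_offdiag: "\<forall>t i j. i \<noteq> j \<longrightarrow> A t $ i $ j \<ge> 0"
    and A_rate_cols: "\<forall>t j. (\<Sum>i\<in>UNIV. A t $ i $ j) = 0"
    and A_int: "\<forall>i j. set_integrable lborel {0..T} (\<lambda>s. A s $ i $ j)"
    and Y: "counting_path y"
    and lam_pos: "\<forall>i. \<forall>t\<ge>0. lam i t > 0"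
    and lam_lc: "\<forall>i. \<forall>t>0. continuous (at_left t) (lam i)"
    and lam_int: "\<forall>i. set_integrable lborel {0..T} (lam i)"
    and q_rc: "\<forall>t\<in>{0..<T}. continuous (at_right t) q"
    and q_ll: "\<forall>t\<in>{0<..T}. \<exists>l. (q \<longlongrightarrow> l) (at_left t)"
    and v_rc: "\<forall>t\<in>{0..<T}. continuous (at_right t) v"
    and v_ll: "\<forall>t\<in>{0<..T}. \<exists>l. (v \<longlongrightarrow> l) (at_left t)"
    and filter_eq: "\<forall>t\<in>{0..T}. q t = q 0
        + (\<Sum>u\<in>jump_times y 0 t. dY y u *\<^sub>R ((Lam lam u - mat 1) *v left_lim q u))
        - set_lebesgue_integral lborel {0<..t} (\<lambda>u. (Lam lam u - mat 1) *v left_lim q u)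
        + set_lebesgue_integral lborel {0<..t} (\<lambda>u. A u *v q u)"
    and smoother_T: "v T = vec 1"
    and smoother_eq: "\<forall>t\<in>{0..T}. v t = vec 1
        + set_lebesgue_integral lborel {t<..T}
            (\<lambda>s. (transpose (A s) - Lam lam s + mat 1) *v left_lim v s)
        - (\<Sum>s\<in>jump_times y t T. dY y s *\<^sub>R ((matrix_inv (Lam lam s) - mat 1) *v left_lim v s))"
  shows "\<forall>t\<in>{0..T}.
      let qb = (\<lambda>s. matrix_inv (Gamma lam y s) *v q s);
          vb = (\<lambda>s. Gamma lam y s *v v s) in
      qb t = qb 0 + set_lebesgue_integral lborel {0<..t}
                 (\<lambda>s. (matrix_inv (Gamma lam y s) ** A s ** Gamma lam y s) *v qb s)
    \<and> vb t = vb 0 - set_lebesgue_integral lborel {0<..t}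
                 (\<lambda>s. (Gamma lam y s ** transpose (A s) ** matrix_inv (Gamma lam y s)) *v vb s)
    \<and> vb t = Gamma lam y T *v vec 1 + set_lebesgue_integral lborel {t<..T}
                 (\<lambda>s. (Gamma lam y s ** transpose (A s) ** matrix_inv (Gamma lam y s)) *v vb s)
    \<and> q t \<bullet> v t = qb t \<bullet> vb t"
proof -
  interpret counting_intensity lam y T
    using T Y lam_pos lam_int by unfold_locales (simp_all add: set_integrable_Icc_imp_Ioc)
  let ?qb = "\<lambda>s. matrix_inv (\<Gamma> s) *v q s" and ?vb = "\<lambda>s. \<Gamma> s *v v s"
  let ?B = "\<lambda>s. matrix_inv (\<Gamma> s) ** A s ** \<Gamma> s"
    and ?C = "\<lambda>s. \<Gamma> s ** transpose (A s) ** matrix_inv (\<Gamma> s)"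
  have A: "set_integrable lborel {0<..T} A"
    using A_int by (simp add: set_integrable_vec_iff set_integrable_Icc_imp_Ioc)
  have cadlag: "cadlag_on 0 T q" "cadlag_on 0 T v"
    using q_rc q_ll v_rc v_ll by (simp_all add: cadlag_on_def)
  have q: "primitive_on 0 T (\<lambda>s. ?B s *v ?qb s) ?qb"
    by (rule filter_gauge_primitive[OF A cadlag(1) filter_eq[folded filter_equation_def]])
  have v: "primitive_on 0 T (\<lambda>s. - (?C s *v ?vb s)) ?vb"
    by (rule smoother_gauge_primitive[OF A cadlag(2) smoother_eq[folded smoother_equation_def]])
  show ?thesis
    unfolding Let_def
  proof (intro ballI conjI)
    fix t assume t: "t \<in> {0..T}"
    show "?qb t = ?qb 0 + (LBINT s:{0<..t}. ?B s *v ?qb s)"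
      using primitive_on_increment[OF q, of 0 t] t by (simp add: algebra_simps)
    show "?vb t = ?vb 0 - (LBINT s:{0<..t}. ?C s *v ?vb s)"
      using primitive_on_increment[OF v, of 0 t] t by (simp add: set_lebesgue_integral_minus algebra_simps)
    show "?vb t = \<Gamma> T *v vec 1 + (LBINT s:{t<..T}. ?C s *v ?vb s)"
      using primitive_on_increment[OF v, of t T] t
      by (simp add: smoother_T set_lebesgue_integral_minus algebra_simps)
  qed (simp add: inner_Gamma)
qed

end
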